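(* Let $p$ be a prime and $e>1$ an integer, and assume $e$ is even if $p=2$. Let $0<\alpha<p^e-1$ and $0<\beta<p^{pe}-1$ be integers such that (i) $\alpha\equiv p^l \pmod{\frac{p^e-1}{p-1}}$ for some $0\le l<e$; (ii) $w_p(\beta)=p-1$; (iii) $w_p\big((\alpha p+\beta)^\dagger\big)=p$. Let $n=\alpha(p^{0\cdot e}+p^{1\cdot e}+\cdots+p^{(p-1)e})+\beta$ and write $(\alpha p+\beta)^\dagger=a_0p^0+\cdots+a_{e-1}p^{e-1}$ with $0\le a_i\le p-1$. Then $g_{n,p}$ is a permutation polynomial of $\mathbb{F}_{p^e}$ if and only if $\gcd(a_0+a_1x+\cdots+a_{e-1}x^{e-1},\ x^e-1)=x-1$ in $\mathbb{F}_p[x]$.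
   Context: For a prime $p$, a power $q$ of $p$ and an integer $n\ge 0$, $g_{n,q}\in\mathbb{F}_p[x]$ is the unique polynomial with $\sum_{a\in\mathbb{F}_q}(x+a)^n=g_{n,q}(x^q-x)$. A permutation polynomial of a finite field $\mathbb{F}$ is a polynomial inducing a bijection of $\mathbb{F}$. For an integer $m\ge 0$ with base-$p$ digits $m=\sum_i m_ip^i$ ($0\le m_i\le p-1$), $w_p(m)=\sum_i m_i$ is the base-$p$ weight. For $m\in\mathbb{Z}$, $m^\dagger$ denotes the unique integer with $1\le m^\dagger\le p^e-1$ and $m^\dagger\equiv m\pmod{p^e-1}$. *)

theory Defs
  imports
    "Berlekamp_Zassenhaus.Finite_Field"
    "HOL-Computational_Algebra.Computational_Algebra"
begin

(* The prime field F_p is 'p mod_ring with CARD('p) = p.  A finite field of p-power order is any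
   type of class {field, finite} of that cardinality. *)

(* The canonical ring homomorphism from F_p.  It sends a residue class to its representative in
   {0..<p}, so it is a homomorphism only if CHAR('a) = CARD('p). *)
definition of_prime_field :: "'p::prime_card mod_ring \<Rightarrow> 'a::ring_1" where
  "of_prime_field c = of_int (to_int_mod_ring c)"

(* g_{n,q} for q = CARD('q), where 'q is a finite field of characteristic p = CARD('p).
   The defining identity is one of polynomials over F_q: the left-hand side is the sum of
   (x + a)^n over all a in F_q, the right-hand side is g(x^q - x). *)
definition g_poly :: "'q::{field,finite} itself \<Rightarrow> nat \<Rightarrow> 'p::prime_card mod_ring poly" where
  "g_poly _ n = (THE g. (\<Sum>a\<in>(UNIV :: 'q set). [:a, 1:] ^ n) =
     pcompose (map_poly of_prime_field g) (monom 1 CARD('q) - [:0, 1:]))"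

definition permutation_poly :: "'a::{field,finite} poly \<Rightarrow> bool" where
  "permutation_poly f \<longleftrightarrow> bij (poly f)"

definition base_digit :: "nat \<Rightarrow> nat \<Rightarrow> nat \<Rightarrow> nat" where
  "base_digit p m i = m div p ^ i mod p"

(* For p > 1 only finitely many digits are nonzero, so this is a finite sum. *)
definition base_weight :: "nat \<Rightarrow> nat \<Rightarrow> nat" where
  "base_weight p m = (\<Sum>i | base_digit p m i \<noteq> 0. base_digit p m i)"

(* The representative of m modulo p^e - 1 in {1..p^e - 1}; multiples of p^e - 1 give p^e - 1. *)
definition dagger :: "nat \<Rightarrow> nat \<Rightarrow> int \<Rightarrow> nat" where
  "dagger p e m =
     (THE r. 1 \<le> r \<and> r \<le> p ^ e - 1 \<and> [int r = m] (mod (int (p ^ e - 1))))"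

end

(* Let Tr be the trace of F_{p^e} over F_p. If x^p - x = y, then x^(p^e) = x + Tr(y), which turns
   g(y), the sum of (x + c)^n over c in F_p, into a sum of powers of small digit weight:
   for Tr(y) <> 0 one gets g(y) = y^alpha * sum_c (x + c)^beta = -y^alpha, and for Tr(y) = 0 one
   gets g(y) = -L(x) - [p = 2] where L(x) = sum_i a_i x^(p^i).
   Both formulas preserve the condition Tr = 0. Since alpha = 1 mod p - 1 and
   alpha = p^l mod (p^e - 1)/(p - 1), the power map is injective, so g is a permutation iff L has
   kernel F_p, and this is the gcd condition because L is a_0 + ... + a_{e-1} X^{e-1} evaluated at the
   Frobenius. *)
theory Submission
  imports Defs
begin

subsection \<open>Finite fields and translation-invariant polynomials\<close>

text \<open>The root x of x^p - x = y lies in the field only when Tr(y) = 0, so the power-sum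
  identities are stated over commutative rings of characteristic p, polynomial rings included. Digit
  weights matter because (x + c)^m, with c in F_p, is a monic polynomial in c whose degree is the
  weight of m, and in degrees up to p a sum over F_p detects only the coefficient of c^(p-1), plus
  that of c^p when p = 2. This exception is the source of the term [p = 2]; evenness of e gives
  Tr(1) = 0 and keeps that term in the kernel of the trace. Dimension arguments over F_p are
  replaced by counting: an additive polynomial of degree p^d has fibres of at most p^d elements,
  which bounds its image from below.\<close>

lemma finite_field_power_card:
  fixes x :: "'a::{field,finite}"
  shows "x ^ CARD('a) = x"
proof (cases "x = 0")
  case False
  have "x * (\<Prod>y\<in>UNIV-{0}. x * y) = x * x ^ (CARD('a) - 1) * \<Prod>(UNIV-{0})"
    by (simp add: prod.distrib mult_ac)
  also have "x * x ^ (CARD('a) - 1) = x ^ Suc (CARD('a) - 1)"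
    by (subst power_Suc) auto
  also have "Suc (CARD('a) - 1) = CARD('a)"
    using finite_UNIV_card_ge_0[where ?'a = 'a] by simp
  also have "(\<Prod>y\<in>UNIV-{0}. x * y) = (\<Prod>y\<in>UNIV-{0}. y)"
    by (rule prod.reindex_bij_witness[of _ "\<lambda>y. y / x" "\<lambda>y. x * y"]) (use False in auto)
  finally show ?thesis
    by simp
qed (use finite_UNIV_card_ge_0[where ?'a = 'a] in auto)

lemma card_UNIV_field_gt_1: "CARD('a::{field,finite}) > 1"
proof -
  have "card {0, 1::'a} \<le> CARD('a)"
    by (intro card_mono) auto
  thus ?thesis by simp
qed

lemma finite_field_power_card_diff_1:
  fixes x :: "'a::{field,finite}"
  assumes "x \<noteq> 0"
  shows "x ^ (CARD('a) - 1) = 1"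
proof -
  have "Suc (CARD('a) - 1) = CARD('a)"
    using card_UNIV_field_gt_1[where 'a = 'a] by simp
  hence "x ^ Suc (CARD('a) - 1) = x"
    using finite_field_power_card by metis
  hence "x * x ^ (CARD('a) - 1) = x * 1" by (simp only: power_Suc mult_1_right)
  thus ?thesis using assms by (simp only: mult_cancel_left) simp
qed

lemma degree_X_power_diff_X:
  assumes "n > 1"
  shows "degree (monom 1 n - [:0, 1:] :: 'a::comm_ring_1 poly) = n"
proof -
  have "degree ([:0, 1:] :: 'a poly) < degree (monom (1 :: 'a) n)"
    using assms by (simp add: degree_monom_eq)
  hence "degree (monom 1 n + (- [:0, 1:]) :: 'a poly) = degree (monom (1 :: 'a) n)"
    by (intro degree_add_eq_left) (simp only: degree_minus)
  thus ?thesis by (simp only: diff_conv_add_uminus) (simp add: degree_monom_eq)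
qed

lemma card_power_eq_bound:
  assumes "n > 0"
  shows "card {x :: 'a::idom. x ^ n = c} \<le> n"
proof -
  let ?P = "monom 1 n - [:c:]"
  have "coeff ?P n = 1" using assms by (simp add: coeff_pCons split: nat.splits)
  hence "?P \<noteq> 0" by (metis coeff_0 zero_neq_one)
  hence "card {x. poly ?P x = 0} \<le> degree ?P" by (rule card_poly_roots_bound)
  also have "degree ?P \<le> n" by (intro degree_diff_le) (simp_all add: degree_monom_le)
  finally show ?thesis by (simp add: poly_monom)
qed

text \<open>Scaling the variable by a unit u multiplies the sum by u^j. Some u has u^j \<noteq> 1,
  since X^j - 1 has at most j roots, fewer than there are units; for j = 0 the sum is q = 0.\<close>

lemma sum_power_finite_field_eq_0:
  assumes "j < CARD('a::{field,finite}) - 1"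
  shows "(\<Sum>x\<in>(UNIV :: 'a set). x ^ j) = 0"
proof (cases "j = 0")
  case True
  have "of_nat CARD('a) = (0 :: 'a)"
    using CHAR_dvd_CARD[where 'a = 'a] by (simp add: of_nat_eq_0_iff_char_dvd)
  with True show ?thesis by simp
next
  case False
  have "\<exists>u::'a. u \<noteq> 0 \<and> u ^ j \<noteq> 1"
  proof (rule ccontr)
    assume "\<not> (\<exists>u::'a. u \<noteq> 0 \<and> u ^ j \<noteq> 1)"
    hence "UNIV - {0} \<subseteq> {x :: 'a. x ^ j = 1}" by auto
    hence "card (UNIV - {0::'a}) \<le> card {x :: 'a. x ^ j = 1}" by (intro card_mono) auto
    also have "\<dots> \<le> j" using False by (intro card_power_eq_bound) auto
    finally show False using assms by (simp add: card_Diff_singleton)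
  qed
  then obtain u :: 'a where u: "u \<noteq> 0" "u ^ j \<noteq> 1" by blast
  have "(\<Sum>x\<in>(UNIV :: 'a set). x ^ j) = (\<Sum>x\<in>(UNIV :: 'a set). (u * x) ^ j)"
    by (rule sum.reindex_bij_witness[of _ "\<lambda>y. u * y" "\<lambda>y. y / u"]) (use u in auto)
  also have "\<dots> = u ^ j * (\<Sum>x\<in>(UNIV :: 'a set). x ^ j)"
    by (simp add: power_mult_distrib sum_distrib_left)
  finally show ?thesis using u by auto
qed

lemma sum_power_finite_field_card_diff_1:
  "(\<Sum>x\<in>(UNIV :: 'a::{field,finite} set). x ^ (CARD('a) - 1)) = -1"
proof -
  have "(\<Sum>x\<in>(UNIV :: 'a set). x ^ (CARD('a) - 1)) = (\<Sum>x\<in>UNIV - {0 :: 'a}. x ^ (CARD('a) - 1))"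
    using card_UNIV_field_gt_1[where 'a = 'a] by (intro sum.mono_neutral_right) auto
  also have "\<dots> = (\<Sum>x\<in>UNIV - {0 :: 'a}. 1)"
    by (intro sum.cong) (auto simp: finite_field_power_card_diff_1 simp del: One_nat_def)
  also have "\<dots> = of_nat (CARD('a) - 1)" by (simp add: card_Diff_singleton)
  also have "\<dots> = of_nat CARD('a) - 1"
    using card_UNIV_field_gt_1[where 'a = 'a] by (subst of_nat_diff) auto
  also have "of_nat CARD('a) = (0 :: 'a)"
    using CHAR_dvd_CARD[where 'a = 'a] by (simp add: of_nat_eq_0_iff_char_dvd)
  finally show ?thesis by simp
qed

text \<open>As x^q = x, this is the sum for exponent 1, and 1 equals q - 1 exactly when q = 2. This
  is where p = 2 starts to differ.\<close>

lemma sum_power_finite_field_card: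
  "(\<Sum>x\<in>(UNIV :: 'a::{field,finite} set). x ^ CARD('a)) = (if CARD('a) = 2 then -1 else 0)"
proof (cases "CARD('a) = 2")
  case True
  thus ?thesis
    using sum_power_finite_field_card_diff_1[where 'a = 'a] finite_field_power_card[where 'a = 'a] by simp
next
  case False
  hence "(\<Sum>x\<in>(UNIV :: 'a set). x ^ 1) = 0"
    using card_UNIV_field_gt_1[where 'a = 'a] by (intro sum_power_finite_field_eq_0) auto
  with False show ?thesis by (simp add: finite_field_power_card)
qed

lemma degree_prod_linear_finite:
  "finite A \<Longrightarrow> degree (\<Prod>c\<in>A. [:f c, 1:] :: 'a::idom poly) = card A"
  by (subst degree_prod_eq_sum_degree) auto

text \<open>Both sides have degree \<open>card B\<close>, the same leading coefficient, and vanish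
  at the \<open>card B\<close> points -b.\<close>

lemma prod_linear_roots:
  fixes B :: "'k::field set"
  assumes "finite B" "card B > 1" "\<And>b. b \<in> B \<Longrightarrow> (- b) ^ card B = - b"
  shows "(\<Prod>b\<in>B. [:b, 1:]) = monom 1 (card B) - [:0, 1:]"
proof (rule poly_eqI_degree_lead_coeff[where n = "card B" and A = "uminus ` B"])
  let ?P = "\<Prod>b\<in>B. [:b, 1:]"
  have deg: "degree ?P = card B" using assms(1) by (rule degree_prod_linear_finite)
  have "lead_coeff ?P = 1" by (simp add: lead_coeff_prod)
  thus "coeff ?P (card B) = coeff (monom 1 (card B) - [:0, 1:]) (card B)"
    using assms(2) by (auto simp: deg coeff_pCons split: nat.splits)
  show "degree ?P \<le> card B" by (simp add: deg)
  show "degree (monom 1 (card B) - [:0, 1:] :: 'k poly) \<le> card B"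
    using assms(2) by (simp add: degree_X_power_diff_X)
  show "card B \<le> card (uminus ` B)" by (simp add: card_image)
  fix z assume "z \<in> uminus ` B"
  then obtain b where b: "b \<in> B" "z = - b" by auto
  hence "\<exists>b\<in>B. poly [:b, 1:] z = 0" by (intro bexI[of _ b]) auto
  hence "poly ?P z = 0" using assms(1) by (simp add: poly_prod)
  moreover have "poly (monom 1 (card B) - [:0, 1:]) z = 0"
    using assms(3)[OF b(1)] by (simp add: poly_monom b)
  ultimately show "poly ?P z = poly (monom 1 (card B) - [:0, 1:]) z" by simp
qed

lemma prod_linear_finite_field:
  "(\<Prod>c\<in>(UNIV :: 'q::{field,finite} set). [:c, 1:]) = monom 1 CARD('q) - [:0, 1:]"
  using card_UNIV_field_gt_1[where 'a = 'q]
  by (intro prod_linear_roots) (simp_all add: finite_field_power_card)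

text \<open>An invariant \<open>f\<close> takes the same value at all \<open>q\<close> points, so \<open>f - f(0)\<close> is divisible by
  \<open>X^q - X\<close>; the quotient is again invariant and has smaller degree.\<close>
lemma translation_invariant_poly:
  fixes f :: "'q::{field,finite} poly"
  assumes "\<And>c. pcompose f [:c, 1:] = f"
  shows "\<exists>h. f = pcompose h (monom 1 CARD('q) - [:0, 1:])"
  using assms
proof (induction "degree f" arbitrary: f rule: less_induct)
  case (less f)
  define W :: "'q poly" where "W = monom 1 CARD('q) - [:0, 1:]"
  have degW: "degree W = CARD('q)"
    unfolding W_def using card_UNIV_field_gt_1[where 'a = 'q] by (intro degree_X_power_diff_X)
  \<comment> \<open>Written as the product of all X + b, \<open>W\<close> is translated by permuting
    its factors.\<close>
  have W_inv: "pcompose W [:c, 1:] = W" for c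
  proof -
    have "pcompose W [:c, 1:] = (\<Prod>b\<in>UNIV. [:b + c, 1:])"
      unfolding W_def prod_linear_finite_field [symmetric]
      by (simp add: pcompose_prod pcompose_pCons)
    also have "\<dots> = (\<Prod>b\<in>UNIV. [:b, 1:])"
      by (rule prod.reindex_bij_witness[of _ "\<lambda>b. b - c" "\<lambda>b. b + c"]) auto
    finally show ?thesis by (simp add: W_def prod_linear_finite_field)
  qed
  have const: "f = [:poly f 0:]" if "degree f < CARD('q)"
  proof (rule poly_eqI_degree[where A = UNIV])
    fix x :: 'q
    have "poly (pcompose f [:x, 1:]) 0 = poly f 0" by (simp only: less.prems)
    thus "poly f x = poly [:poly f 0:] x" by (simp add: poly_pcompose)
  qed (use that in auto)
  show ?case
  proof (cases "degree f < CARD('q)")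
    case True
    show ?thesis by (rule exI[of _ "[:poly f 0:]"], subst pcompose_const, rule const[OF True])
  next
    case False
    define g where "g = f - [:poly f 0:]"
    have g_inv: "pcompose g [:c, 1:] = g" for c
      using less.prems by (simp add: g_def pcompose_diff)
    have g_root: "poly g x = 0" for x
    proof -
      have "poly (pcompose f [:x, 1:]) 0 = poly f 0" by (simp only: less.prems)
      thus ?thesis by (simp add: poly_pcompose g_def)
    qed
    have W_root: "poly W x = 0" for x
      by (simp add: W_def poly_monom finite_field_power_card)
    have "W \<noteq> 0" using degW card_UNIV_field_gt_1[where 'a = 'q] by auto
    have "g mod W = 0"
    proof (rule poly_eqI_degree[where A = UNIV])
      fix x :: 'q
      have "poly g x = poly (g div W * W + g mod W) x" by simp
      thus "poly (g mod W) x = poly 0 x" by (simp only: poly_add poly_mult W_root g_root) simp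
      show "degree (g mod W) < CARD('q)"
      proof (cases "g mod W = 0")
        case False
        from degree_mod_less'[OF \<open>W \<noteq> 0\<close> this] degW show ?thesis by simp
      qed simp
    qed auto
    then obtain h where h: "g = W * h" by (meson dvd_def mod_0_imp_dvd)
    have h_inv: "pcompose h [:c, 1:] = h" for c
      using g_inv[of c] \<open>W \<noteq> 0\<close> by (simp add: h pcompose_mult W_inv)
    have "degree h < degree f"
    proof (cases "h = 0")
      case False
      have "degree g \<le> degree f" unfolding g_def by (intro degree_diff_le) auto
      moreover have "degree g = CARD('q) + degree h"
        using False \<open>W \<noteq> 0\<close> by (simp add: h degree_mult_eq degW)
      ultimately show ?thesis using card_UNIV_field_gt_1[where 'a = 'q] by simp
    qed (use False card_UNIV_field_gt_1[where 'a = 'q] in auto)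
    from less.hyps[OF this h_inv] obtain k where k: "h = pcompose k W"
      unfolding W_def by blast
    have "f = pcompose (pCons (poly f 0) k) W"
      using h by (simp add: pcompose_pCons g_def k algebra_simps)
    thus ?thesis unfolding W_def by blast
  qed
qed

section \<open>The embedding of the prime field and the defining identity of g\<close>

text \<open>Reduction modulo p is invisible in characteristic p. Every residue class is some
  \<open>of_nat m\<close>, so the homomorphism laws follow from those of
  \<open>of_nat\<close>.\<close>

lemma of_prime_field_of_nat:
  assumes "CHAR('k::comm_ring_1) = CARD('p::prime_card)"
  shows "(of_prime_field (of_nat m :: 'p mod_ring) :: 'k) = of_nat m"
proof -
  have "to_int_mod_ring (of_nat m :: 'p mod_ring) = int m mod int CARD('p)"
    by transfer simp
  hence "(of_prime_field (of_nat m :: 'p mod_ring) :: 'k) = of_nat (m mod CARD('p))"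
    unfolding of_prime_field_def by (metis of_int_of_nat_eq of_nat_mod)
  also have "\<dots> = of_nat m"
    using assms by (simp add: of_nat_eq_iff_cong_CHAR)
  finally show ?thesis .
qed

lemma of_prime_field_hom:
  assumes "CHAR('k::comm_ring_1) = CARD('p::prime_card)"
  shows "comm_ring_hom (of_prime_field :: 'p mod_ring \<Rightarrow> 'k)"
proof
  note [simp] = of_prime_field_of_nat[OF assms]
  show "of_prime_field (0 :: 'p mod_ring) = (0 :: 'k)" "of_prime_field (1 :: 'p mod_ring) = (1 :: 'k)"
    by (simp_all add: of_prime_field_def)
  fix x y :: "'p mod_ring"
  obtain i j where [simp]: "x = of_nat i" "y = of_nat j" using surj_of_nat_mod_ring by meson
  show "of_prime_field (x + y) = (of_prime_field x + of_prime_field y :: 'k)"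
    using of_prime_field_of_nat[OF assms, of "i + j"] by simp
  show "of_prime_field (x * y) = (of_prime_field x * of_prime_field y :: 'k)"
    using of_prime_field_of_nat[OF assms, of "i * j"] by simp
qed

lemma of_prime_field_id: "(of_prime_field :: 'p::prime_card mod_ring \<Rightarrow> 'p mod_ring) = id"
  by (rule ext) (simp add: of_prime_field_def of_int_of_int_mod_ring)

text \<open>Discharges the \<open>THE\<close> in \<open>g_poly\<close>: a translation only permutes
  the summands, which gives existence, and composition with a nonconstant polynomial is injective,
  which gives uniqueness.\<close>

lemma g_poly_prime_field:
  "(\<Sum>a\<in>(UNIV :: 'p::prime_card mod_ring set). [:a, 1:] ^ n) =
     pcompose (g_poly TYPE('p mod_ring) n) (monom 1 CARD('p) - [:0, 1:])"
proof -
  define f where "f = (\<Sum>a\<in>(UNIV :: 'p mod_ring set). [:a, 1:] ^ n)"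
  define W :: "'p mod_ring poly" where "W = monom 1 CARD('p) - [:0, 1:]"
  have deg: "degree W > 0"
    unfolding W_def using nontriv[where 'a = 'p] by (subst degree_X_power_diff_X) auto
  have "pcompose f [:c, 1:] = f" for c
  proof -
    have "pcompose f [:c, 1:] = (\<Sum>a\<in>UNIV. [:a + c, 1:] ^ n)"
      by (simp add: f_def pcompose_sum pcompose_hom.hom_power pcompose_pCons)
    also have "\<dots> = f" unfolding f_def
      by (rule sum.reindex_bij_witness[of _ "\<lambda>b. b - c" "\<lambda>b. b + c"]) auto
    finally show ?thesis .
  qed
  from translation_invariant_poly[OF this] obtain h where h: "f = pcompose h W"
    by (auto simp: W_def)
  have uniq: "g = h" if "f = pcompose g W" for g
  proof -
    have "pcompose (g - h) W = 0" using that h by (simp add: pcompose_diff)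
    thus ?thesis using pcompose_eq_0[of "g - h" W] deg by simp
  qed
  have "g_poly TYPE('p mod_ring) n = h"
    unfolding g_poly_def of_prime_field_id map_poly_id id_apply CARD_mod_ring
      f_def [symmetric] W_def [symmetric]
    using h uniq by (intro the_equality) blast+
  with h show ?thesis by (simp add: f_def W_def)
qed

text \<open>The identity over F_p is carried along the embedding and z is substituted for the
  variable. Taking z to be a polynomial leaves room for computing modulo X^p - X - y when this has
  no root in the field.\<close>

lemma pcompose_g_poly:
  fixes z :: "'k::comm_ring_1 poly"
  assumes char: "CHAR('k) = CARD('p::prime_card)"
  shows "pcompose (map_poly of_prime_field (g_poly TYPE('p mod_ring) n :: 'p mod_ring poly)) 
           (z ^ CARD('p) - z) =
         (\<Sum>c\<in>(UNIV :: 'p mod_ring set). (z + [:of_prime_field c:]) ^ n)"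
proof -
  interpret comm_ring_hom "of_prime_field :: 'p mod_ring \<Rightarrow> 'k"
    by (rule of_prime_field_hom[OF char])
  interpret P: map_poly_comm_ring_hom "of_prime_field :: 'p mod_ring \<Rightarrow> 'k" ..
  have "map_poly of_prime_field (monom 1 CARD('p) - [:0, 1:] :: 'p mod_ring poly) =
          (monom 1 CARD('p) - [:0, 1:] :: 'k poly)"
    by (simp add: P.hom_minus)
  hence "(\<Sum>a\<in>(UNIV :: 'p mod_ring set). [:of_prime_field a, 1:] ^ n) =
     pcompose (map_poly of_prime_field (g_poly TYPE('p mod_ring) n :: 'p mod_ring poly))
        (monom 1 CARD('p) - [:0, 1:] :: 'k poly)"
    using arg_cong[OF g_poly_prime_field[where 'p = 'p, of n], of "map_poly (of_prime_field :: _ \<Rightarrow> 'k)"]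
    by (simp add: P.hom_sum P.hom_power map_poly_pcompose)
  from arg_cong[OF this, of "\<lambda>f. pcompose f z"] show ?thesis
    by (simp add: pcompose_sum pcompose_hom.hom_power pcompose_pCons pcompose_diff 
        pcompose_assoc [symmetric] monom_altdef add.commute)
qed

lemma poly_g_poly:
  fixes x :: "'k::comm_ring_1"
  assumes char: "CHAR('k) = CARD('p::prime_card)"
  shows "poly (map_poly of_prime_field (g_poly TYPE('p mod_ring) n :: 'p mod_ring poly)) 
           (x ^ CARD('p) - x) =
         (\<Sum>c\<in>(UNIV :: 'p mod_ring set). (x + of_prime_field c) ^ n)"
  using arg_cong[OF pcompose_g_poly[OF char, of n "[:x:]"], of "\<lambda>f. poly f 0"]
  by (simp add: poly_pcompose poly_sum)

subsection \<open>Power sums and digit weights\<close>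

lemma finite_field_power_card_power:
  fixes x :: "'a::{field,finite}"
  shows "x ^ (CARD('a) ^ i) = x"
  by (induction i) (simp_all add: finite_field_power_card power_mult)

text \<open>After swapping the sums only power sums over F_p remain: they vanish below exponent p -
  1, equal -1 there, and at exponent p equal -1 or 0 according to whether p = 2.\<close>

lemma sum_poly_prime_field:
  fixes Q :: "'k::comm_ring_1 poly"
  assumes char: "CHAR('k) = CARD('p::prime_card)" and deg: "degree Q \<le> CARD('p)"
  shows "(\<Sum>c\<in>(UNIV :: 'p mod_ring set). poly Q (of_prime_field c)) =
           - coeff Q (CARD('p) - 1) - (if CARD('p) = 2 then coeff Q CARD('p) else 0)"
proof -
  interpret comm_ring_hom "of_prime_field :: 'p mod_ring \<Rightarrow> 'k"
    by (rule of_prime_field_hom[OF char])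
  have p: "CARD('p) > 1" by (rule nontriv)
  define S where "S j = (\<Sum>c\<in>(UNIV :: 'p mod_ring set). c ^ j)" for j
  have S: "S j = 0" if "j < CARD('p) - 1" for j
    unfolding S_def using that sum_power_finite_field_eq_0[where 'a = "'p mod_ring"] by simp
  have S1: "S (CARD('p) - 1) = -1"
    unfolding S_def using sum_power_finite_field_card_diff_1[where 'a = "'p mod_ring"] by simp
  have S2: "S CARD('p) = (if CARD('p) = 2 then -1 else 0)"
    unfolding S_def using sum_power_finite_field_card[where 'a = "'p mod_ring"] by simp
  have "poly Q z = (\<Sum>j\<le>CARD('p). coeff Q j * z ^ j)" for z
    unfolding poly_altdef using deg by (intro sum.mono_neutral_left) (auto simp: coeff_eq_0)
  hence "(\<Sum>c\<in>(UNIV :: 'p mod_ring set). poly Q (of_prime_field c)) =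
      (\<Sum>c\<in>(UNIV :: 'p mod_ring set). \<Sum>j\<le>CARD('p). coeff Q j * of_prime_field c ^ j)" by simp
  also have "\<dots> = (\<Sum>j\<le>CARD('p). coeff Q j * of_prime_field (S j))"
    by (subst sum.swap) (simp add: S_def hom_sum hom_power sum_distrib_left)
  also have "\<dots> = (\<Sum>j\<in>{CARD('p) - 1, CARD('p)}. coeff Q j * of_prime_field (S j))"
  proof (rule sum.mono_neutral_right)
    show "\<forall>j\<in>{..CARD('p)} - {CARD('p) - 1, CARD('p)}. coeff Q j * of_prime_field (S j) = 0"
    proof
      fix j assume "j \<in> {..CARD('p)} - {CARD('p) - 1, CARD('p)}"
      hence "j < CARD('p) - 1" by auto
      thus "coeff Q j * of_prime_field (S j) = 0" by (simp add: S)
    qed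
  qed auto
  also have "\<dots> = - coeff Q (CARD('p) - 1) - (if CARD('p) = 2 then coeff Q CARD('p) else 0)"
    using p by (simp add: S1 S2 hom_uminus del: One_nat_def)
  finally show ?thesis .
qed

text \<open>At \<open>w = 0\<close> the truncated \<open>w - 1\<close> would point back to the
  leading coefficient, so s is set to 0, the value of an empty sum of roots up to sign.\<close>

definition monic_subleading :: "'a::comm_ring_1 poly \<Rightarrow> nat \<Rightarrow> 'a \<Rightarrow> bool" where
  "monic_subleading Q w s \<longleftrightarrow>
     degree Q \<le> w \<and> coeff Q w = 1 \<and> (if w = 0 then s = 0 else coeff Q (w - 1) = s)"

lemma monic_subleading_linear_mult:
  assumes "monic_subleading Q w s"
  shows "monic_subleading ([:r, 1:] * Q) (Suc w) (r + s)"
proof -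
  have "degree ([:r, 1:] * Q) \<le> degree [:r, 1:] + degree Q" by (rule degree_mult_le)
  moreover have "coeff Q (Suc w) = 0"
    using assms by (intro coeff_eq_0) (auto simp: monic_subleading_def)
  ultimately show ?thesis
    using assms by (auto simp: monic_subleading_def coeff_pCons split: nat.splits if_splits)
qed

lemma monic_subleading_linear_power_mult:
  assumes "monic_subleading Q w s"
  shows "monic_subleading ([:r, 1:] ^ d * Q) (d + w) (of_nat d * r + s)"
proof (induction d)
  case (Suc d)
  from monic_subleading_linear_mult[OF this, of r] show ?case
    by (simp add: algebra_simps)
qed (use assms in auto)

lemma monic_subleading_prod:
  fixes r :: "nat \<Rightarrow> 'a::comm_ring_1"
  shows "monic_subleading (\<Prod>i<k. [:r i, 1:] ^ d i) (\<Sum>i<k. d i) (\<Sum>i<k. of_nat (d i) * r i)"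
proof (induction k)
  case 0
  show ?case by (simp add: monic_subleading_def)
next
  case (Suc k)
  from monic_subleading_linear_power_mult[OF this, of "r k" "d k"] show ?case
    by (simp add: mult.commute add.commute)
qed

text \<open>Frobenius fixes c, so the p^i-th power of x + c is x^(p^i) + c. The power becomes a
  product of linear factors in c, one for each unit of digit sum.\<close>

lemma power_digit_sum:
  fixes x :: "'k::comm_ring_1"
  assumes char: "CHAR('k) = CARD('p::prime_card)"
  shows "(x + of_prime_field (c :: 'p mod_ring)) ^ (\<Sum>i<k. d i * CARD('p) ^ i) =
           poly (\<Prod>i<k. [:x ^ (CARD('p) ^ i), 1:] ^ d i) (of_prime_field c)"
proof -
  interpret comm_ring_hom "of_prime_field :: 'p mod_ring \<Rightarrow> 'k"
    by (rule of_prime_field_hom[OF char])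
  have "(x + of_prime_field c) ^ (CARD('p) ^ i) = x ^ (CARD('p) ^ i) + of_prime_field c" for i
  proof -
    have "(x + of_prime_field c) ^ (CARD('p) ^ i) =
        x ^ (CARD('p) ^ i) + of_prime_field c ^ (CARD('p) ^ i)"
      using prime_card[where 'a = 'p] by (intro freshmans_dream') (simp_all add: char)
    also have "of_prime_field c ^ (CARD('p) ^ i) = (of_prime_field (c ^ (CARD('p) ^ i)) :: 'k)"
      by (simp add: hom_power)
    also have "c ^ (CARD('p) ^ i) = c"
      using finite_field_power_card_power[of c i] by simp
    finally show ?thesis .
  qed
  thus ?thesis
    by (simp add: power_sum poly_prod poly_power power_mult mult.commute[of "d _"] add.commute)
qed

text \<open>Here the product of linear factors has degree p - 1 in c, and only its leading
  coefficient 1 survives the summation.\<close>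

lemma sum_power_weight_p_minus_1:
  fixes x :: "'k::comm_ring_1"
  assumes char: "CHAR('k) = CARD('p::prime_card)" and w: "(\<Sum>i<k. d i) = CARD('p) - 1"
  shows "(\<Sum>c\<in>(UNIV :: 'p mod_ring set).
           (x + of_prime_field c) ^ (\<Sum>i<k. d i * CARD('p) ^ i)) = -1"
proof -
  define Q where "Q = (\<Prod>i<k. [:x ^ (CARD('p) ^ i), 1:] ^ d i)"
  have Q: "degree Q \<le> CARD('p) - 1" "coeff Q (CARD('p) - 1) = 1"
    using monic_subleading_prod[of "\<lambda>i. x ^ (CARD('p) ^ i)" d k]
    unfolding Q_def [symmetric] w monic_subleading_def by auto
  have "coeff Q CARD('p) = 0"
    using Q(1) nontriv[where 'a = 'p] by (intro coeff_eq_0) linarith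
  moreover have "degree Q \<le> CARD('p)" using Q(1) by linarith
  ultimately show ?thesis
    unfolding power_digit_sum[OF char] Q_def [symmetric]
    by (simp only: sum_poly_prime_field[OF char] Q(2)) simp
qed

text \<open>In degree p the surviving coefficient is the subleading one, the sum of the constants
  x^(p^i) with multiplicity \<open>d i\<close>. For p = 2 the leading coefficient survives
  too.\<close>

lemma sum_power_weight_p:
  fixes x :: "'k::comm_ring_1"
  assumes char: "CHAR('k) = CARD('p::prime_card)" and w: "(\<Sum>i<k. d i) = CARD('p)"
  shows "(\<Sum>c\<in>(UNIV :: 'p mod_ring set).
           (x + of_prime_field c) ^ (\<Sum>i<k. d i * CARD('p) ^ i)) =
         - (\<Sum>i<k. of_nat (d i) * x ^ (CARD('p) ^ i)) - (if CARD('p) = 2 then 1 else 0)"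
proof -
  define Q where "Q = (\<Prod>i<k. [:x ^ (CARD('p) ^ i), 1:] ^ d i)"
  have Q: "degree Q \<le> CARD('p)" "coeff Q CARD('p) = 1"
    "coeff Q (CARD('p) - 1) = (\<Sum>i<k. of_nat (d i) * x ^ (CARD('p) ^ i))"
    using monic_subleading_prod[of "\<lambda>i. x ^ (CARD('p) ^ i)" d k] nontriv[where 'a = 'p]
    unfolding Q_def [symmetric] w monic_subleading_def by auto
  show ?thesis
    unfolding power_digit_sum[OF char] Q_def [symmetric]
    by (simp only: sum_poly_prime_field[OF char Q(1)] Q(2,3))
qed

section \<open>Base-p expansions and weights\<close>

lemma base_weight_eq_sum:
  assumes "p > 1" "m < p ^ k"
  shows "base_weight p m = (\<Sum>i<k. base_digit p m i)"
proof -
  have "base_digit p m i = 0" if "i \<ge> k" for i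
  proof -
    have "m < p ^ i" using assms power_increasing[OF that, of p] by linarith
    thus ?thesis by (simp add: base_digit_def)
  qed
  hence "{i. base_digit p m i \<noteq> 0} \<subseteq> {..<k}"
    by (auto intro: ccontr simp: not_less)
  thus ?thesis unfolding base_weight_def by (intro sum.mono_neutral_left) auto
qed

lemma base_weight_add_mult:
  assumes "p > 1" "r < p"
  shows "base_weight p (r + p * m) = r + base_weight p m"
proof -
  have "base_digit p (r + p * m) 0 = r" using assms by (simp add: base_digit_def)
  moreover have "base_digit p (r + p * m) (Suc i) = base_digit p m i" for i
    using assms by (simp add: base_digit_def div_mult2_eq)
  moreover obtain k where k: "m < p ^ k"
    using assms(1) power_gt_expt[of p m] by auto
  moreover have "r + p * m < p ^ Suc k"
  proof -
    have "r + p * m < p * Suc m" using assms by simp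
    also have "\<dots> \<le> p * p ^ k" using k by (intro mult_left_mono) auto
    finally show ?thesis by simp
  qed
  ultimately show ?thesis
    using base_weight_eq_sum[OF assms(1), of "r + p * m" "Suc k"]
      base_weight_eq_sum[OF assms(1), of m k]
    by (simp only: sum.lessThan_Suc_shift)
qed

lemma digit_sum_Suc:
  fixes d :: "nat \<Rightarrow> nat"
  shows "(\<Sum>i<Suc k. d i * p ^ i) = d 0 + p * (\<Sum>i<k. d (Suc i) * p ^ i)"
  unfolding sum.lessThan_Suc_shift by (simp add: sum_distrib_left mult_ac)

lemma base_weight_digit_sum:
  assumes "p > 1" "\<And>i. i < k \<Longrightarrow> d i < p"
  shows "base_weight p (\<Sum>i<k. d i * p ^ i) = (\<Sum>i<k. d i)"
  using assms(2)
proof (induction k arbitrary: d)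
  case 0
  show ?case by (simp add: base_weight_def base_digit_def)
next
  case (Suc k)
  show ?case
    unfolding digit_sum_Suc base_weight_add_mult[OF assms(1) Suc.prems[OF zero_less_Suc]]
      sum.lessThan_Suc_shift
    using Suc.IH[of "\<lambda>i. d (Suc i)"] Suc.prems by simp
qed

lemma digit_sum_exists:
  assumes "p > (1::nat)"
  shows "\<exists>k d. m = (\<Sum>i<k. d i * p ^ i) \<and> (\<forall>i. d i < p)"
proof (induction m rule: less_induct)
  case (less m)
  show ?case
  proof (cases "m = 0")
    case True
    thus ?thesis using assms by (intro exI[of _ 0] exI[of _ "\<lambda>_. 0"]) auto
  next
    case False
    with less[of "m div p"] assms obtain k d
      where d: "m div p = (\<Sum>i<k. d i * p ^ i)" "\<And>i. d i < p" by auto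
    have "m = m mod p + p * (m div p)" by simp
    also have "\<dots> = (\<Sum>i<Suc k. case_nat (m mod p) d i * p ^ i)"
      unfolding digit_sum_Suc d(1) by simp
    finally show ?thesis using d(2) assms
      by (intro exI[of _ "Suc k"] exI[of _ "case_nat (m mod p) d"]) (auto split: nat.splits)
  qed
qed

lemma digit_sum_base_weight_exists:
  assumes "p > (1::nat)"
  obtains k d where "m = (\<Sum>i<k. d i * p ^ i)" "(\<Sum>i<k. d i) = base_weight p m"
  using digit_sum_exists[OF assms, of m] base_weight_digit_sum[OF assms] by metis

text \<open>Casting out nines in base p: every p^i is 1 modulo p - 1.\<close>

lemma cong_base_weight:
  assumes "p > 1"
  shows "[m = base_weight p m] (mod (p - 1))"
proof -
  obtain k d where d: "m = (\<Sum>i<k. d i * p ^ i)" "(\<Sum>i<k. d i) = base_weight p m"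
    using digit_sum_base_weight_exists[OF assms] .
  have "[p = 1] (mod (p - 1))"
    using assms by (simp add: cong_def mod_if le_mod_geq)
  hence "[d i * p ^ i = d i * 1 ^ i] (mod (p - 1))" for i
    by (intro cong_mult cong_pow) auto
  hence "[(\<Sum>i<k. d i * p ^ i) = (\<Sum>i<k. d i)] (mod (p - 1))"
    by (intro cong_sum) simp
  thus ?thesis using d by simp
qed

subsection \<open>Linearized polynomials\<close>

text \<open>This is the action of F_p[T] on the ring in which T acts as the Frobenius; as a
  polynomial in x it is the p-polynomial associated with \<open>P\<close>.\<close>

definition linearized :: "'p::prime_card mod_ring poly \<Rightarrow> 'k::comm_ring_1 \<Rightarrow> 'k" where
  "linearized P x = (\<Sum>i\<le>degree P. of_prime_field (coeff P i) * x ^ (CARD('p) ^ i))"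

context
  assumes char: "CHAR('k::field) = CARD('p::prime_card)"
begin

interpretation comm_ring_hom "of_prime_field :: 'p mod_ring \<Rightarrow> 'k"
  by (rule of_prime_field_hom[OF char])

lemma frobenius_add: "((x :: 'k) + y) ^ (CARD('p) ^ i) = x ^ (CARD('p) ^ i) + y ^ (CARD('p) ^ i)"
  using prime_card[where 'a = 'p] by (intro freshmans_dream') (simp_all add: char)

lemma frobenius_diff: "((x :: 'k) - y) ^ (CARD('p) ^ i) = x ^ (CARD('p) ^ i) - y ^ (CARD('p) ^ i)"
  using frobenius_add[of "x - y" y i] by simp

lemma of_prime_field_power_card:
  "(of_prime_field (c :: 'p mod_ring) :: 'k) ^ (CARD('p) ^ i) = of_prime_field c"
proof -
  have "c ^ (CARD('p) ^ i) = c" using finite_field_power_card_power[of c i] by simp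
  thus ?thesis by (metis hom_power)
qed

lemma linearized_eq_sum:
  assumes "degree (P :: 'p mod_ring poly) \<le> n"
  shows "linearized P (x :: 'k) = (\<Sum>i\<le>n. of_prime_field (coeff P i) * x ^ (CARD('p) ^ i))"
  unfolding linearized_def using assms
  by (intro sum.mono_neutral_left) (auto simp: coeff_eq_0)

lemma linearized_0_left [simp]: "linearized (0 :: 'p mod_ring poly) (x :: 'k) = 0"
  by (simp add: linearized_def)

lemma linearized_add_left:
  "linearized (P + Q :: 'p mod_ring poly) (x :: 'k) = linearized P x + linearized Q x"
proof -
  define n where "n = max (degree P) (degree Q)"
  have "degree P \<le> n" "degree Q \<le> n" "degree (P + Q) \<le> n"
    by (auto simp: n_def degree_add_le_max)
  thus ?thesis
    by (simp add: linearized_eq_sum hom_add ring_distribs sum.distrib)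
qed

lemma linearized_sum_left:
  "linearized (\<Sum>i\<in>A. P i :: 'p mod_ring poly) (x :: 'k) = (\<Sum>i\<in>A. linearized (P i) x)"
  by (induction A rule: infinite_finite_induct) (simp_all add: linearized_add_left)

lemma linearized_smult:
  "linearized (smult c P :: 'p mod_ring poly) (x :: 'k) = of_prime_field c * linearized P x"
  using linearized_eq_sum[OF degree_smult_le, of c P x]
  by (simp add: linearized_def hom_mult sum_distrib_left mult.assoc)

lemma linearized_monom:
  "linearized (monom c i :: 'p mod_ring poly) (x :: 'k) = of_prime_field c * x ^ (CARD('p) ^ i)"
proof -
  have "linearized (monom c i) x =
      (\<Sum>j\<le>i. if i = j then of_prime_field c * x ^ (CARD('p) ^ j) else 0)"
    unfolding linearized_eq_sum[OF degree_monom_le] by (intro sum.cong) auto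
  thus ?thesis by simp
qed

lemma linearized_1: "linearized (1 :: 'p mod_ring poly) (x :: 'k) = x"
  using linearized_monom[of 1 0 x] by simp

text \<open>Frobenius is additive and fixes the coefficients, so a p-th power shifts every exponent
  by one. This recursion matches induction on polynomials.\<close>

lemma linearized_pCons:
  "linearized (pCons c P :: 'p mod_ring poly) (x :: 'k) =
     of_prime_field c * x + linearized P x ^ CARD('p)"
proof -
  have "linearized P x ^ CARD('p) =
          (\<Sum>i\<le>degree P. (of_prime_field (coeff P i) * x ^ (CARD('p) ^ i)) ^ CARD('p))"
    unfolding linearized_def using prime_card[where 'a = 'p]
    by (intro freshmans_dream_sum) (simp_all add: char)
  also have "\<dots> = (\<Sum>i\<le>degree P. of_prime_field (coeff P i) * x ^ (CARD('p) ^ Suc i))"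
    using of_prime_field_power_card[of _ 1]
    by (simp add: power_mult_distrib power_mult [symmetric] mult.commute)
  finally show ?thesis
    unfolding linearized_eq_sum[OF degree_pCons_le] sum.atMost_Suc_shift by simp
qed

lemma linearized_diff: "linearized (P :: 'p mod_ring poly) (x - y :: 'k) = linearized P x - linearized P y"
  by (simp add: linearized_def frobenius_diff ring_distribs sum_subtractf)

lemma linearized_0 [simp]: "linearized (P :: 'p mod_ring poly) (0 :: 'k) = 0"
  using linearized_diff[of P 0 0] by simp

text \<open>Turning products into compositions makes divisibility in F_p[T] a statement about
  kernels and images.\<close>

lemma linearized_mult:
  "linearized (P * Q :: 'p mod_ring poly) (x :: 'k) = linearized P (linearized Q x)"
  by (induction P) (simp_all add: mult_pCons_left linearized_add_left linearized_smult linearized_pCons)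

lemma linearized_X_minus_1: "linearized ([:-1, 1:] :: 'p mod_ring poly) (x :: 'k) = x ^ CARD('p) - x"
  by (simp add: linearized_pCons hom_uminus power_0_left)

text \<open>A fibre is the root set of \<open>R\<close>, of degree at most p^(degree P).
  \<open>R\<close> is nonzero because the embedding sends the invertible leading coefficient of
  \<open>P\<close> to a nonzero element.\<close>

lemma card_linearized_fiber:
  assumes "(P :: 'p mod_ring poly) \<noteq> 0"
  shows "card {x :: 'k. linearized P x = c} \<le> CARD('p) ^ degree P"
proof -
  define R where
    "R = (\<Sum>i\<le>degree P. monom (of_prime_field (coeff P i)) (CARD('p) ^ i)) - [:c:]"
  have p: "CARD('p) > 1" by (rule nontriv)
  have "coeff R (CARD('p) ^ degree P) =
      (\<Sum>i\<le>degree P. if i = degree P then of_prime_field (coeff P i) else 0)"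
    using p by (auto simp: R_def coeff_sum coeff_pCons split: nat.splits intro!: sum.cong)
  hence "coeff R (CARD('p) ^ degree P) = of_prime_field (lead_coeff P)" by simp
  moreover have "of_prime_field (lead_coeff P) \<noteq> (0 :: 'k)"
  proof
    assume "of_prime_field (lead_coeff P) = (0 :: 'k)"
    hence "of_prime_field (lead_coeff P * inverse (lead_coeff P)) = (0 :: 'k)"
      by (simp only: hom_mult mult_zero_left)
    thus False using assms by simp
  qed
  ultimately have "R \<noteq> 0" by auto
  hence "card {x. poly R x = 0} \<le> degree R" by (rule card_poly_roots_bound)
  also have "degree R \<le> CARD('p) ^ degree P"
    unfolding R_def using p
    by (intro degree_diff_le degree_sum_le order.trans[OF degree_monom_le] power_increasing) auto
  also have "{x. poly R x = 0} = {x. linearized P x = c}"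
    by (simp add: R_def poly_sum poly_monom linearized_def)
  finally show ?thesis .
qed

end

lemma card_le_card_range_mult:
  fixes f :: "'a::finite \<Rightarrow> 'b"
  assumes "\<And>y. card {x. f x = y} \<le> m"
  shows "CARD('a) \<le> card (range f) * m"
proof -
  have "CARD('a) = (\<Sum>y\<in>range f. card {x. f x = y})"
    using sum.image_gen[of UNIV "\<lambda>_. 1::nat" f] by simp
  also have "\<dots> \<le> (\<Sum>y\<in>range f. m)" by (intro sum_mono assms)
  finally show ?thesis by simp
qed

text \<open>A counting substitute for rank-nullity: small fibres force a large image.\<close>

lemma card_le_card_range_linearized:
  fixes P :: "'p::prime_card mod_ring poly"
  assumes char: "CHAR('k::{field,finite}) = CARD('p)" and "P \<noteq> 0"
  shows "CARD('k) \<le> card (range (linearized P :: 'k \<Rightarrow> 'k)) * CARD('p) ^ degree P"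
  using card_linearized_fiber[OF assms] by (intro card_le_card_range_mult)

lemma linearized_monom_minus_1:
  fixes y :: "'k::{field,finite}"
  assumes char: "CHAR('k) = CARD('p::prime_card)" and card: "CARD('k) = CARD('p) ^ e"
  shows "linearized (monom 1 e - 1 :: 'p mod_ring poly) y = 0"
proof -
  interpret comm_ring_hom "of_prime_field :: 'p mod_ring \<Rightarrow> 'k"
    by (rule of_prime_field_hom[OF char])
  have "linearized (monom 1 e :: 'p mod_ring poly) y =
     linearized (monom 1 e - 1 :: 'p mod_ring poly) y + linearized (1 :: 'p mod_ring poly) y"
    unfolding linearized_add_left[OF char, symmetric] by simp
  thus ?thesis
    using linearized_1[OF char, of y] finite_field_power_card[of y]
    by (simp add: linearized_monom[OF char] card)
qed

text \<open>If \<open>D\<close> is the gcd and \<open>X^e - 1 = D * E\<close>, then the image of \<open>E\<close> lies in the kernel of \<open>D\<close>;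
  as the fibres of \<open>E\<close> have at most \<open>p ^ degree E\<close> elements, a kernel of size at most \<open>p\<close> forces
  \<open>degree D \<le> 1\<close>.\<close>
lemma linearized_kernel_iff_gcd:
  fixes A :: "'p::prime_card mod_ring poly"
  assumes char: "CHAR('k::{field,finite}) = CARD('p)" and card: "CARD('k) = CARD('p) ^ e"
    and "[:-1, 1:] dvd A"
  shows "(\<forall>x::'k. linearized A x = 0 \<longrightarrow> x ^ CARD('p) = x) \<longleftrightarrow> gcd A (monom 1 e - 1) = [:-1, 1:]"
proof
  note [simp] = linearized_0[OF char]
  define D where "D = gcd A (monom 1 e - 1)"
  note Xe = linearized_monom_minus_1[OF char card]
  {
    assume gcd: "gcd A (monom 1 e - 1) = [:-1, 1:]"
    \<comment> \<open>By Bezout, x^p - x is a sum of \<open>u\<close> applied to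
      \<open>linearized A x\<close> and \<open>v\<close> applied to the action of T^e - 1, and both
      inputs are 0.\<close>
    obtain u v where uv: "u * A + v * (monom 1 e - 1) = [:-1, 1:]"
      using bezout_coefficients_fst_snd[of A "monom 1 e - 1"] unfolding gcd by blast
    show "\<forall>x::'k. linearized A x = 0 \<longrightarrow> x ^ CARD('p) = x"
    proof (intro allI impI)
      fix x :: 'k
      assume "linearized A x = 0"
      hence "linearized (u * A + v * (monom 1 e - 1)) x = 0"
        by (simp only: linearized_add_left[OF char] linearized_mult[OF char] Xe) simp
      thus "x ^ CARD('p) = x" unfolding uv linearized_X_minus_1[OF char] by simp
    qed
  }
  {
    assume ker: "\<forall>x::'k. linearized A x = 0 \<longrightarrow> x ^ CARD('p) = x"
    have p: "CARD('p) > 1" by (rule nontriv)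
    have "e > 0" using card_UNIV_field_gt_1[where 'a = 'k] card by (cases e) auto
    have Xe0: "degree (monom 1 e - 1 :: 'p mod_ring poly) = e"
    proof -
      have "degree (monom 1 e + (-1) :: 'p mod_ring poly) = degree (monom (1 :: 'p mod_ring) e)"
        using \<open>e > 0\<close> by (intro degree_add_eq_left) (simp add: degree_monom_eq)
      thus ?thesis by (simp add: degree_monom_eq)
    qed
    have "D \<noteq> 0" using Xe0 \<open>e > 0\<close> by (auto simp: D_def)
    obtain A' where A': "A = A' * D" unfolding D_def by (metis dvd_def gcd_dvd1 mult.commute)
    obtain E where E: "monom 1 e - 1 = D * E" unfolding D_def by (metis dvd_def gcd_dvd2)
    have "E \<noteq> 0" using E Xe0 \<open>e > 0\<close> by auto
    have deg: "e = degree D + degree E"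
      using Xe0 \<open>D \<noteq> 0\<close> \<open>E \<noteq> 0\<close> by (simp add: E degree_mult_eq)
    have "range (linearized E :: 'k \<Rightarrow> 'k) \<subseteq> {y. y ^ CARD('p) = y}"
    proof safe
      fix x :: 'k
      have "linearized D (linearized E x) = 0"
        using Xe[of x] unfolding E linearized_mult[OF char] .
      hence "linearized A (linearized E x) = 0"
        by (simp add: A' linearized_mult[OF char])
      with ker show "linearized E x ^ CARD('p) = linearized E x" by blast
    qed
    hence "card (range (linearized E :: 'k \<Rightarrow> 'k)) \<le> card {y :: 'k. y ^ CARD('p) = y}"
      by (intro card_mono) auto
    \<comment> \<open>The fixed points of Frobenius are the zero fibre of T - 1, which has degree
      1.\<close>
    also have "\<dots> \<le> CARD('p)"
      using card_linearized_fiber[OF char, of "[:-1, 1:]" 0]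
      by (simp add: linearized_X_minus_1[OF char])
    finally have "CARD('k) \<le> CARD('p) * CARD('p) ^ degree E"
      using card_le_card_range_linearized[OF char \<open>E \<noteq> 0\<close>] by (meson le_trans mult_le_mono1)
    hence "CARD('p) ^ e \<le> CARD('p) ^ Suc (degree E)" by (simp add: card)
    hence "e \<le> Suc (degree E)" using p by (simp add: power_increasing_iff del: power_Suc)
    hence "degree D \<le> 1" using deg by simp
    have "[:-1, 1:] dvd (monom 1 e - 1 :: 'p mod_ring poly)"
      using poly_eq_0_iff_dvd[of "monom 1 e - 1 :: 'p mod_ring poly" 1] by (simp add: poly_monom)
    hence "[:-1, 1:] dvd D" unfolding D_def using assms(3) by (intro gcd_greatest)
    then obtain B where B: "D = [:-1, 1:] * B" by (elim dvdE)
    hence "B \<noteq> 0" using \<open>D \<noteq> 0\<close> by auto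
    hence "degree D = 1 + degree B" unfolding B by (subst degree_mult_eq) auto
    hence "degree B = 0" using \<open>degree D \<le> 1\<close> by simp
    hence "is_unit B" using \<open>B \<noteq> 0\<close> by (metis is_unit_iff_degree)
    hence "normalize D = normalize [:-1, 1:]" unfolding B by (rule normalize_mult_unit_right)
    moreover have "normalize D = D" by (simp add: D_def)
    moreover have "normalize ([:-1, 1:] :: 'p mod_ring poly) = [:-1, 1:]" by (intro normalize_monic) simp
    ultimately show "gcd A (monom 1 e - 1) = [:-1, 1:]" by (simp add: D_def)
  }
qed

subsection \<open>Values of the polynomial \<open>g\<close>\<close>

lemma cong_pcompose:
  fixes f u v w :: "'k::field poly"
  assumes "[u = v] (mod w)"
  shows "[pcompose f u = pcompose f v] (mod w)"
proof (induction f)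
  case (pCons c f)
  thus ?case unfolding pcompose_pCons using assms by (intro cong_add cong_mult cong_refl)
qed simp

lemma power_eq_if_cong:
  fixes x :: "'a::monoid_mult"
  assumes "x ^ m = 1" "[a = b] (mod m)"
  shows "x ^ a = x ^ b"
proof -
  have "x ^ k = x ^ (k mod m)" for k
  proof -
    have "x ^ k = x ^ (m * (k div m) + k mod m)" by simp
    also have "\<dots> = x ^ (k mod m)" by (simp only: power_add power_mult assms(1)) simp
    finally show ?thesis .
  qed
  with assms(2) show ?thesis unfolding cong_def by metis
qed

text \<open>Positive exponents take care of x = 0, where 0^0 = 1 would break the claim. The range of
  \<open>dagger\<close> starts at 1, which supplies this.\<close>

lemma finite_field_power_eq_if_cong:
  fixes x :: "'a::{field,finite}"
  assumes "[m = m'] (mod (CARD('a) - 1))" "m > 0" "m' > 0"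
  shows "x ^ m = x ^ m'"
proof (cases "x = 0")
  case False
  thus ?thesis by (intro power_eq_if_cong[OF _ assms(1)] finite_field_power_card_diff_1)
qed (use assms in \<open>simp add: power_0_left\<close>)

lemma cong_dagger:
  assumes "p ^ e > 1"
  shows "dagger p e m \<ge> 1" "[int (dagger p e m) = m] (mod (int (p ^ e - 1)))"
proof -
  define M where "M = p ^ e - 1"
  have "M > 0" using assms by (simp add: M_def)
  define P where "P r \<longleftrightarrow> 1 \<le> r \<and> r \<le> M \<and> [int r = m] (mod (int M))" for r :: nat
  have "\<exists>!r. P r"
  proof (rule ex_ex1I)
    define s where "s = nat (m mod int M)"
    have s: "int s = m mod int M" "s < M"
      using \<open>M > 0\<close> by (auto simp: s_def nat_less_iff)
    show "\<exists>r. P r"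
    proof (cases "s = 0")
      case True
      hence "P M" using \<open>M > 0\<close> s by (simp add: P_def cong_def)
      thus ?thesis ..
    next
      case False
      hence "P s" using s by (simp add: P_def cong_def)
      thus ?thesis ..
    qed
    fix r r' assume r: "P r" "P r'"
    hence "[int r = int r'] (mod (int M))" by (metis P_def cong_sym cong_trans)
    hence cong: "[r = r'] (mod M)" by (simp add: cong_int_iff)
    show "r = r'"
    proof (cases "r = M \<or> r' = M")
      \<comment> \<open>If one representative is M, the other is a positive multiple of M not
        exceeding M.\<close>
      case True
      hence "M dvd r" "M dvd r'" using cong by (auto simp: cong_def dvd_eq_mod_eq_0)
      thus ?thesis using r by (auto simp: P_def dvd_imp_le dest!: dvd_imp_le intro: antisym)
    next
      case False
      thus ?thesis using r cong by (intro cong_less_modulus_unique_nat[OF cong]) (auto simp: P_def)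
    qed
  qed
  from theI'[OF this] show "dagger p e m \<ge> 1" "[int (dagger p e m) = m] (mod (int (p ^ e - 1)))"
    unfolding dagger_def P_def M_def by auto
qed

text \<open>Its linearization \<open>\<Sum>i<e. y ^ (p ^ i)\<close> is the absolute trace.\<close>
abbreviation geom_poly :: "nat \<Rightarrow> 'p::prime_card mod_ring poly" where
  "geom_poly e \<equiv> (\<Sum>i<e. monom 1 i)"

text \<open>The sum telescopes. Through \<open>linearized\<close> it says that trace values are
  fixed by Frobenius and that the trace kills every x^p - x.\<close>

lemma geom_poly_mult_X_minus_1: "geom_poly e * [:-1, 1:] = monom 1 e - 1"
proof (induction e)
  case (Suc e)
  have "monom 1 e * [:-1, 1:] = monom 1 (Suc e) - (monom 1 e :: 'a mod_ring poly)"
    by (simp add: monom_Suc smult_monom minus_monom [symmetric])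
  with Suc show ?case by (simp only: sum.lessThan_Suc distrib_right) simp
qed simp

lemma degree_geom_poly_le: "degree (geom_poly e) \<le> e - 1"
  by (intro degree_sum_le order.trans[OF degree_monom_le]) auto

text \<open>Modulo \<open>W\<close> the p-th power of X is X + y. Each further p-th power raises the
  accumulated constant to the p and adds y, which extends the partial trace by one term.\<close>

lemma cong_X_power:
  fixes y :: "'k::field"
  assumes char: "CHAR('k) = CARD('p::prime_card)"
  defines "W \<equiv> [:0, 1:] ^ CARD('p) - [:0, 1:] - [:y:]"
  shows "[[:0, 1:] ^ (CARD('p) ^ k) = [:0, 1:] + [:\<Sum>i<k. y ^ (CARD('p) ^ i):]] (mod W)"
proof (induction k)
  case 0
  show ?case by simp
next
  case (Suc k)
  have frob: "(u + v) ^ CARD('p) = u ^ CARD('p) + v ^ CARD('p)" for u v :: "'k poly"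
    using prime_card[where 'a = 'p] by (intro freshmans_dream) (simp_all add: char)
  define s where "s k = (\<Sum>i<k. y ^ (CARD('p) ^ i))" for k
  have "s k ^ CARD('p) = (\<Sum>i<k. (y ^ (CARD('p) ^ i)) ^ CARD('p))" unfolding s_def
    using prime_card[where 'a = 'p] by (intro freshmans_dream_sum) (simp_all add: char)
  hence s: "s (Suc k) = y + s k ^ CARD('p)"
    unfolding s_def sum.lessThan_Suc_shift by (simp add: power_mult [symmetric] mult.commute)
  have "[([:0, 1:] ^ (CARD('p) ^ k)) ^ CARD('p) = ([:0, 1:] + [:s k:]) ^ CARD('p)] (mod W)"
    using Suc.IH unfolding s_def by (rule cong_pow)
  also have "([:0, 1:] + [:s k:]) ^ CARD('p) = W + ([:0, 1:] + ([:y:] + [:s k ^ CARD('p):]))"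
    unfolding frob by (simp add: W_def poly_const_pow)
  also have "[\<dots> = [:0, 1:] + ([:y:] + [:s k ^ CARD('p):])] (mod W)"
    by (simp add: cong_def)
  finally show ?case
    unfolding s_def [symmetric] s by (simp add: power_mult [symmetric] mult.commute)
qed

lemma of_prime_field_poly:
  assumes char: "CHAR('k::comm_ring_1) = CARD('p::prime_card)"
  shows "(of_prime_field (c :: 'p mod_ring) :: 'k poly) = [:of_prime_field c:]"
  by (simp add: of_prime_field_def of_int_poly)

text \<open>The elements i * t with i < p are distinct and fixed by Frobenius, so they are all the
  roots of X^p - X; z is then substituted for X.\<close>

lemma prod_add_multiples:
  fixes t :: "'k::field"
  assumes char: "CHAR('k) = CARD('p::prime_card)" and t: "t \<noteq> 0" "t ^ CARD('p) = t"
  shows "(\<Prod>i<CARD('p). z + [:of_nat i * t:]) = z ^ CARD('p) - z"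
proof -
  have inj: "inj_on (\<lambda>i. of_nat i * t) {..<CARD('p)}"
    using t by (auto simp: inj_on_def of_nat_eq_iff_cong_CHAR char cong_def)
  define B where "B = (\<lambda>i. of_nat i * t) ` {..<CARD('p)}"
  have card: "card B = CARD('p)" by (simp add: B_def card_image[OF inj])
  have "(- b) ^ CARD('p) = - b" if "b \<in> B" for b
  proof -
    have "(of_nat i :: 'k) ^ CARD('p) = of_nat i" for i
      using of_prime_field_power_card[OF char, of "of_nat i" 1] by (simp add: of_prime_field_of_nat[OF char])
    hence "b ^ CARD('p) = b" using that t by (auto simp: B_def power_mult_distrib)
    \<comment> \<open>Writing -b as 0 - b treats the sign without distinguishing p = 2 from odd
      p.\<close>
    thus ?thesis using frobenius_diff[OF char, of 0 b 1] by (simp add: power_0_left)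
  qed
  hence "(\<Prod>b\<in>B. [:b, 1:]) = monom 1 CARD('p) - [:0, 1:]"
    using prod_linear_roots[of B] card nontriv[where 'a = 'p] by (simp add: B_def)
  hence "(\<Prod>i<CARD('p). [:of_nat i * t, 1:]) = monom 1 CARD('p) - [:0, 1:]"
    unfolding B_def by (subst (asm) prod.reindex[OF inj]) simp
  from arg_cong[OF this, of "\<lambda>f. pcompose f z"] show ?thesis
    by (simp add: pcompose_prod pcompose_pCons pcompose_diff monom_altdef 
        pcompose_hom.hom_power add.commute)
qed

lemma linearized_geom_poly:
  fixes y :: "'k::field"
  assumes char: "CHAR('k) = CARD('p::prime_card)"
  shows "linearized (geom_poly e :: 'p mod_ring poly) y = (\<Sum>i<e. y ^ (CARD('p) ^ i))"
proof -
  interpret comm_ring_hom "of_prime_field :: 'p mod_ring \<Rightarrow> 'k"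
    by (rule of_prime_field_hom[OF char])
  show ?thesis by (simp add: linearized_sum_left[OF char] linearized_monom[OF char])
qed

lemma trace_power_card:
  fixes y :: "'k::{field,finite}"
  assumes char: "CHAR('k) = CARD('p::prime_card)" and card: "CARD('k) = CARD('p) ^ e"
  defines "t \<equiv> linearized (geom_poly e :: 'p mod_ring poly) y"
  shows "t ^ CARD('p) = t"
proof -
  have "linearized ([:-1, 1:] * geom_poly e :: 'p mod_ring poly) y = 0"
    unfolding mult.commute[of "[:-1, 1:]"] geom_poly_mult_X_minus_1 
    by (rule linearized_monom_minus_1[OF char card])
  thus ?thesis
    by (simp only: linearized_mult[OF char] linearized_X_minus_1[OF char] t_def) simp
qed

lemma trace_linearized_eq_0:
  fixes x :: "'k::{field,finite}" and A :: "'p::prime_card mod_ring poly"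
  assumes char: "CHAR('k) = CARD('p)" and card: "CARD('k) = CARD('p) ^ e" and "[:-1, 1:] dvd A"
  shows "linearized (geom_poly e :: 'p mod_ring poly) (linearized A x) = 0"
proof -
  obtain B where "A = [:-1, 1:] * B" using assms(3) by (elim dvdE)
  hence "geom_poly e * A = (monom 1 e - 1) * B"
    by (metis geom_poly_mult_X_minus_1 mult.assoc)
  hence "linearized (geom_poly e * A) x = 0"
    by (simp only: linearized_mult[OF char] linearized_monom_minus_1[OF char card])
  thus ?thesis by (simp only: linearized_mult[OF char])
qed

text \<open>Additive Hilbert 90 by counting. The image of x^p - x lies in the kernel of the trace;
  it has at least p^(e-1) elements because its fibres have at most p, and the kernel has at most
  p^(e-1) because \<open>geom_poly e\<close> has degree at most e - 1.\<close>

lemma trace_eq_0_imp: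
  fixes y :: "'k::{field,finite}"
  assumes char: "CHAR('k) = CARD('p::prime_card)" and card: "CARD('k) = CARD('p) ^ e" and "e > 0"
    and y: "linearized (geom_poly e :: 'p mod_ring poly) y = 0"
  shows "\<exists>x. y = x ^ CARD('p) - x"
proof -
  define R where "R = range (linearized ([:-1, 1:] :: 'p mod_ring poly) :: 'k \<Rightarrow> 'k)"
  define K where "K = {y :: 'k. linearized (geom_poly e :: 'p mod_ring poly) y = 0}"
  have p: "CARD('p) > 1" by (rule nontriv)
  have "R \<subseteq> K" unfolding R_def K_def using trace_linearized_eq_0[OF char card] by auto
  moreover have "card K \<le> card R"
  proof -
    have "(geom_poly e :: 'p mod_ring poly) \<noteq> 0"
    proof
      assume "(geom_poly e :: 'p mod_ring poly) = 0"
      hence "coeff (geom_poly e :: 'p mod_ring poly) 0 = 0" by simp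
      thus False using \<open>e > 0\<close> by (simp add: coeff_sum)
    qed
    from card_linearized_fiber[OF char this]
    have "card K \<le> CARD('p) ^ degree (geom_poly e :: 'p mod_ring poly)" unfolding K_def .
    also have "\<dots> \<le> CARD('p) ^ (e - 1)"
      using p by (intro power_increasing degree_geom_poly_le) auto
    finally have K: "card K \<le> CARD('p) ^ (e - 1)" .
    have "CARD('p) ^ e \<le> card R * CARD('p)"
      using card_le_card_range_linearized[OF char, of "[:-1, 1:]"] by (simp add: R_def card)
    also have "CARD('p) ^ e = CARD('p) ^ (e - 1) * CARD('p)"
      using \<open>e > 0\<close> by (cases e) auto
    finally show ?thesis using K p by simp
  qed
  ultimately have "R = K" by (intro card_seteq) auto
  moreover have "y \<in> K" using y by (simp add: K_def)
  ultimately show ?thesis by (auto simp: R_def linearized_X_minus_1[OF char])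
qed

text \<open>A root of \<open>X^p - X - y\<close> lives in an extension field; reducing polynomials modulo
  \<open>W = X^p - X - y\<close> replaces it. Modulo \<open>W\<close> the Frobenius of the ground field acts as the
  translation \<open>X \<mapsto> X + Tr(y)\<close>, so for \<open>Tr(y) \<noteq> 0\<close> the norm-like factor of \<open>(X + c)^n\<close> is the product
  of all translates of \<open>X\<close> by elements of the prime field and equals \<open>X^p - X = y\<close>.\<close>
lemma g_poly_trace_nonzero:
  fixes y :: "'k::{field,finite}"
  assumes char: "CHAR('k) = CARD('p::prime_card)" and card: "CARD('k) = CARD('p) ^ e"
    and w: "base_weight CARD('p) \<beta> = CARD('p) - 1"
    and y: "linearized (geom_poly e :: 'p mod_ring poly) y \<noteq> 0"
  shows "poly (map_poly of_prime_field
           (g_poly TYPE('p mod_ring) (\<alpha> * (\<Sum>i<CARD('p). CARD('p) ^ (i * e)) + \<beta>) :: 'p mod_ring poly)) y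
         = - (y ^ \<alpha>)"
proof -
  define X :: "'k poly" where "X = [:0, 1:]"
  define W where "W = X ^ CARD('p) - X - [:y:]"
  define t where "t = linearized (geom_poly e :: 'p mod_ring poly) y"
  define n where "n = \<alpha> * (\<Sum>i<CARD('p). CARD('p) ^ (i * e)) + \<beta>"
  define G where "G = map_poly (of_prime_field :: _ \<Rightarrow> 'k) (g_poly TYPE('p mod_ring) n :: 'p mod_ring poly)"
  have charX: "CHAR('k poly) = CARD('p)" by (simp add: char)
  have frob: "(u + v) ^ (CARD('p) ^ k) = u ^ (CARD('p) ^ k) + v ^ (CARD('p) ^ k)"
    for u v :: "'k poly" and k
    using prime_card[where 'a = 'p] by (intro freshmans_dream') (simp_all add: char)
  have const: "[:z:] ^ (CARD('p) ^ (i * e)) = [:z:]" for z :: 'k and i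
    using finite_field_power_card_power[of z i]
    by (simp add: poly_const_pow card power_mult [symmetric] mult.commute)
  have X_y: "[X ^ CARD('p) - X = [:y:]] (mod W)"
    by (simp add: W_def cong_iff_dvd_diff)
  have X_e: "[X ^ (CARD('p) ^ e) = X + [:t:]] (mod W)"
    using cong_X_power[OF char, where y = y and k = e] by (simp add: t_def linearized_geom_poly[OF char] X_def W_def)
  \<comment> \<open>Constants from the field are fixed by the p^e-th power, so each iteration just
    adds \<open>t\<close>.\<close>
  have X_ie: "[X ^ (CARD('p) ^ (i * e)) = X + [:of_nat i * t:]] (mod W)" for i
  proof (induction i)
    case (Suc i)
    have "[(X ^ (CARD('p) ^ (i * e))) ^ (CARD('p) ^ e) = (X + [:of_nat i * t:]) ^ (CARD('p) ^ e)] (mod W)"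
      using Suc.IH by (rule cong_pow)
    also have "(X + [:of_nat i * t:]) ^ (CARD('p) ^ e) = X ^ (CARD('p) ^ e) + [:of_nat i * t:]"
      unfolding frob using const[of "of_nat i * t" 1] by simp
    also have "[\<dots> = (X + [:t:]) + [:of_nat i * t:]] (mod W)"
      using X_e by (intro cong_add cong_refl)
    finally show ?case
      by (simp add: power_mult [symmetric] power_add algebra_simps)
  qed simp
  \<comment> \<open>Replacing X by X + c with c fixed by Frobenius changes neither the translation
    law nor the value of X^p - X.\<close>
  have main: "[(X + [:c:]) ^ n = [:y ^ \<alpha>:] * (X + [:c:]) ^ \<beta>] (mod W)" if c: "c ^ CARD('p) = c" for c
  proof -
    define z where "z = X + [:c:]"
    have "[z ^ (CARD('p) ^ (i * e)) = z + [:of_nat i * t:]] (mod W)" for i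
    proof -
      have "z ^ (CARD('p) ^ (i * e)) = X ^ (CARD('p) ^ (i * e)) + [:c:]"
        unfolding z_def frob const ..
      also have "[\<dots> = (X + [:of_nat i * t:]) + [:c:]] (mod W)"
        by (intro cong_add cong_refl X_ie)
      finally show ?thesis by (simp add: z_def algebra_simps)
    qed
    hence "[z ^ (\<Sum>i<CARD('p). CARD('p) ^ (i * e)) = (\<Prod>i<CARD('p). z + [:of_nat i * t:])] (mod W)"
      unfolding power_sum by (intro cong_prod)
    also have "(\<Prod>i<CARD('p). z + [:of_nat i * t:]) = z ^ CARD('p) - z"
      using y trace_power_card[OF char card, of y] unfolding t_def [symmetric]
      by (intro prod_add_multiples[OF char])
    also have "\<dots> = X ^ CARD('p) - X"
      using frob[of X "[:c:]" 1] by (simp add: z_def poly_const_pow c)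
    also note X_y
    finally have "[(z ^ (\<Sum>i<CARD('p). CARD('p) ^ (i * e))) ^ \<alpha> * z ^ \<beta> = [:y:] ^ \<alpha> * z ^ \<beta>] (mod W)"
      by (intro cong_mult cong_pow cong_refl)
    thus ?thesis
      by (simp add: n_def z_def power_add power_mult [symmetric] mult.commute poly_const_pow)
  qed
  obtain k d where d: "\<beta> = (\<Sum>i<k. d i * CARD('p) ^ i)" "(\<Sum>i<k. d i) = CARD('p) - 1"
    using digit_sum_base_weight_exists[of "CARD('p)" \<beta>] nontriv[where 'a = 'p] w by metis
  have "[pcompose G [:y:] = pcompose G (X ^ CARD('p) - X)] (mod W)"
    using X_y by (intro cong_pcompose) (rule cong_sym)
  also have "pcompose G (X ^ CARD('p) - X) =
      (\<Sum>c\<in>(UNIV :: 'p mod_ring set). (X + [:of_prime_field c:]) ^ n)"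
    unfolding G_def by (rule pcompose_g_poly[OF char])
  also have "[\<dots> = (\<Sum>c\<in>(UNIV :: 'p mod_ring set).
      [:y ^ \<alpha>:] * (X + [:of_prime_field c:]) ^ \<beta>)] (mod W)"
    using of_prime_field_power_card[OF char, of _ 1] by (intro cong_sum main) simp
  also have "(\<Sum>c\<in>(UNIV :: 'p mod_ring set). [:y ^ \<alpha>:] * (X + [:of_prime_field c:]) ^ \<beta>) =
      [:y ^ \<alpha>:] * (\<Sum>c\<in>(UNIV :: 'p mod_ring set). (X + of_prime_field c) ^ \<beta>)"
    by (simp only: sum_distrib_left of_prime_field_poly[OF char])
  also have "\<dots> = [:- (y ^ \<alpha>):]"
    unfolding d(1) sum_power_weight_p_minus_1[OF charX d(2)] by simp
  finally have "W dvd [:poly G y + y ^ \<alpha>:]"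
    by (simp add: pcompose_pCons_0 cong_iff_dvd_diff)
  moreover have "degree W = CARD('p)"
  proof -
    have "degree ((monom 1 CARD('p) - [:0, 1:]) + (- [:y:]) :: 'k poly) = CARD('p)"
      using degree_X_power_diff_X[where 'a = 'k, OF nontriv[where 'a = 'p]] nontriv[where 'a = 'p]
      by (subst degree_add_eq_left) auto
    thus ?thesis by (simp only: W_def X_def monom_altdef smult_1_left diff_conv_add_uminus)
  qed
  \<comment> \<open>\<open>W\<close> has degree p > 0, so the only constant it divides is 0.\<close>
  ultimately have "[:poly G y + y ^ \<alpha>:] = 0"
    using nontriv[where 'a = 'p] dvd_imp_degree_le[of W "[:poly G y + y ^ \<alpha>:]"] by fastforce
  thus ?thesis by (simp add: G_def n_def eq_neg_iff_add_eq_0)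
qed

text \<open>With x in the field, each p^(ie)-th power fixes x + c, so the sum of p such exponents
  acts as exponent p. The total exponent becomes \<alpha> p + \<beta>, and then \<open>N\<close>
  modulo p^e - 1.\<close>

lemma g_poly_trace_zero:
  fixes x :: "'k::{field,finite}"
  assumes char: "CHAR('k) = CARD('p::prime_card)" and card: "CARD('k) = CARD('p) ^ e"
    and pos: "\<alpha> > 0" "N > 0" and cong: "[\<alpha> * CARD('p) + \<beta> = N] (mod (CARD('p) ^ e - 1))"
    and N: "N = (\<Sum>i<k. d i * CARD('p) ^ i)" and d: "(\<Sum>i<k. d i) = CARD('p)"
  shows "poly (map_poly of_prime_field
           (g_poly TYPE('p mod_ring) (\<alpha> * (\<Sum>i<CARD('p). CARD('p) ^ (i * e)) + \<beta>) :: 'p mod_ring poly))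
             (x ^ CARD('p) - x)
         = - (\<Sum>i<k. of_nat (d i) * x ^ (CARD('p) ^ i)) - (if CARD('p) = 2 then 1 else 0)"
proof -
  have "z ^ (\<alpha> * (\<Sum>i<CARD('p). CARD('p) ^ (i * e)) + \<beta>) = z ^ N" for z :: 'k
  proof -
    have "z ^ (CARD('p) ^ (i * e)) = z" for i
      using finite_field_power_card_power[of z i]
      by (simp add: card power_mult [symmetric] mult.commute)
    hence "z ^ (\<Sum>i<CARD('p). CARD('p) ^ (i * e)) = z ^ CARD('p)"
      unfolding power_sum by simp
    hence "z ^ (\<alpha> * (\<Sum>i<CARD('p). CARD('p) ^ (i * e)) + \<beta>) = z ^ (\<alpha> * CARD('p) + \<beta>)"
      by (simp only: power_add mult.commute[of \<alpha>] power_mult)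
    also have "\<dots> = z ^ N"
      using cong pos by (intro finite_field_power_eq_if_cong) (auto simp: card)
    finally show ?thesis .
  qed
  thus ?thesis
    unfolding poly_g_poly[OF char] using sum_power_weight_p[OF char d, of x] by (simp only: N)
qed

section \<open>The power map with exponent \<alpha>\<close>

text \<open>The modulus is the exponent of the norm to F_p: \<open>b\<close> is the norm of y, hence
  fixed by Frobenius, and \<alpha> differs from p^l by a multiple of that exponent.\<close>

lemma power_eq_mult_frobenius:
  fixes y :: "'k::{field,finite}"
  assumes card: "CARD('k) = p ^ e" and "p > 1"
    and \<alpha>: "[\<alpha> = p ^ l] (mod ((p ^ e - 1) div (p - 1)))" and y: "y \<noteq> 0"
  obtains c where "c \<noteq> 0" "c ^ p = c" "y ^ \<alpha> = c * y ^ (p ^ l)"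
proof -
  define b where "b = y ^ ((p ^ e - 1) div (p - 1))"
  have "b \<noteq> 0" using y by (simp add: b_def)
  have "(p - 1) dvd (p ^ e - 1)"
  proof -
    have "[p = 1] (mod (p - 1))" using \<open>p > 1\<close> by (simp add: cong_altdef_nat)
    from cong_pow[OF this, of e] show ?thesis
      using \<open>p > 1\<close> by (simp add: cong_altdef_nat)
  qed
  hence "b ^ (p - 1) = y ^ (p ^ e - 1)"
    by (simp add: b_def power_mult [symmetric])
  hence "b ^ (p - 1) = 1" using finite_field_power_card_diff_1[OF y] by (simp add: card)
  hence b: "b ^ p = b"
    using \<open>p > 1\<close> power_minus_mult[of p b] by simp
  \<comment> \<open>Multiples are added on both sides because either of \<alpha> and p^l may be the
    larger; hence the quotient of powers of \<open>b\<close> below.\<close>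
  obtain i j where ij: "\<alpha> + i * ((p ^ e - 1) div (p - 1)) = p ^ l + j * ((p ^ e - 1) div (p - 1))"
    using \<alpha> by (metis cong_iff_lin_nat mult.commute)
  have "y ^ \<alpha> * b ^ i = y ^ (p ^ l) * b ^ j"
    using arg_cong[OF ij, of "\<lambda>k. y ^ k"]
    by (simp only: b_def power_add mult.commute[of _ "_ div _"] power_mult)
  hence "y ^ \<alpha> = (b ^ j / b ^ i) * y ^ (p ^ l)"
    using \<open>b \<noteq> 0\<close> by (simp add: field_simps)
  moreover have "(b ^ j / b ^ i) ^ p = b ^ j / b ^ i"
  proof -
    have "(b ^ k) ^ p = b ^ k" for k
      using b by (metis mult.commute power_mult)
    thus ?thesis by (simp only: power_divide)
  qed
  ultimately show ?thesis using that[of "b ^ j / b ^ i"] \<open>b \<noteq> 0\<close> by simp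
qed

lemma linearized_fixed_mult:
  fixes c y :: "'k::field" and P :: "'p::prime_card mod_ring poly"
  assumes "c ^ CARD('p) = c"
  shows "linearized P (c * y) = c * linearized P y"
proof -
  have "c ^ (CARD('p) ^ i) = c" for i
    by (induction i) (simp_all add: assms power_mult)
  thus ?thesis by (simp add: linearized_def power_mult_distrib sum_distrib_left mult_ac)
qed

text \<open>The p^l-th power is the action of T^l, and F_p[T] is commutative.\<close>

lemma linearized_frobenius:
  fixes y :: "'k::field" and P :: "'p::prime_card mod_ring poly"
  assumes char: "CHAR('k) = CARD('p)"
  shows "linearized P (y ^ (CARD('p) ^ l)) = linearized P y ^ (CARD('p) ^ l)"
proof -
  interpret comm_ring_hom "of_prime_field :: 'p mod_ring \<Rightarrow> 'k"
    by (rule of_prime_field_hom[OF char])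
  have "linearized (P * monom 1 l) y = linearized (monom 1 l * P) y"
    by (simp only: mult.commute)
  thus ?thesis by (simp add: linearized_mult[OF char] linearized_monom[OF char])
qed

text \<open>From 1 = c u^(p^l) with c fixed by Frobenius, u^(p^l) is fixed too, and so is u because
  Frobenius is injective. Then u^(p-1) = 1, and the second congruence gives u = u^\<alpha> = 1.
  Applied to a quotient, this is injectivity of the power map on units.\<close>

lemma power_eq_1_imp:
  fixes u :: "'k::{field,finite}"
  assumes char: "CHAR('k) = CARD('p::prime_card)" and card: "CARD('k) = CARD('p) ^ e"
    and \<alpha>: "[\<alpha> = CARD('p) ^ l] (mod ((CARD('p) ^ e - 1) div (CARD('p) - 1)))"
      "[\<alpha> = 1] (mod (CARD('p) - 1))"
    and "u \<noteq> 0" "u ^ \<alpha> = 1"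
  shows "u = 1"
proof -
  have p: "CARD('p) > 1" by (rule nontriv)
  obtain c where c: "c \<noteq> 0" "c ^ CARD('p) = c" "u ^ \<alpha> = c * u ^ (CARD('p) ^ l)"
    using power_eq_mult_frobenius[OF card p \<alpha>(1) \<open>u \<noteq> 0\<close>] .
  have "c ^ CARD('p) * (u ^ (CARD('p) ^ l)) ^ CARD('p) = c * u ^ (CARD('p) ^ l)"
    using c(3) \<open>u ^ \<alpha> = 1\<close> by (metis power_mult_distrib power_one)
  hence "(u ^ CARD('p)) ^ (CARD('p) ^ l) = u ^ (CARD('p) ^ l)"
    using c(1,2) by (simp add: power_mult [symmetric] mult.commute)
  hence "(u ^ CARD('p) - u) ^ (CARD('p) ^ l) = 0"
    by (simp add: frobenius_diff[OF char])
  hence "u ^ CARD('p) = u" by simp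
  hence "u * u ^ (CARD('p) - 1) = u * 1"
    using p power_minus_mult[of "CARD('p)" u] by (simp add: mult.commute)
  hence "u ^ (CARD('p) - 1) = 1" using \<open>u \<noteq> 0\<close> by (simp only: mult_cancel_left) simp
  from power_eq_if_cong[OF this \<alpha>(2)] show ?thesis using \<open>u ^ \<alpha> = 1\<close> by simp
qed

lemma CHAR_eq_if_CARD_eq_power:
  assumes "CARD('k::{field,finite}) = p ^ e" "prime p"
  shows "CHAR('k) = p"
proof -
  have "prime CHAR('k)"
    using finite_imp_CHAR_pos[where 'a = 'k] by (intro prime_CHAR_semidom) auto
  moreover have "CHAR('k) dvd p ^ e" using CHAR_dvd_CARD[where 'a = 'k] assms by simp
  ultimately show ?thesis using assms(2) by (metis prime_dvd_power primes_dvd_imp_eq)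
qed

section \<open>The permutation criterion\<close>

theorem theorem3p1:
  fixes p e \<alpha> \<beta> n :: nat and a :: "nat \<Rightarrow> nat"
  assumes "prime p" and card_p: "CARD('p::prime_card) = p"
    and card_field: "CARD('a::{field,finite}) = p ^ e"
    and "e > 1" and "p = 2 \<Longrightarrow> even e"
    and "0 < \<alpha>" "\<alpha> < p ^ e - 1"
    and "0 < \<beta>" "\<beta> < p ^ (p * e) - 1"
    and "\<exists>l<e. [\<alpha> = p ^ l] (mod ((p ^ e - 1) div (p - 1)))"
    and "base_weight p \<beta> = p - 1"
    and "base_weight p (dagger p e (int (\<alpha> * p + \<beta>))) = p"
    and "n = \<alpha> * (\<Sum>i<p. p ^ (i * e)) + \<beta>"
    and "dagger p e (int (\<alpha> * p + \<beta>)) = (\<Sum>i<e. a i * p ^ i)"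
    and "\<And>i. i < e \<Longrightarrow> a i \<le> p - 1"
  shows "permutation_poly
           (map_poly of_prime_field (g_poly TYPE('p mod_ring) n :: 'p mod_ring poly) :: 'a poly)
         \<longleftrightarrow>
         gcd (\<Sum>i<e. monom (of_nat (a i)) i) (monom 1 e - 1) = ([:- 1, 1:] :: 'p mod_ring poly)"
proof -
  note p_eq = card_p [symmetric]
  note asm = assms(4-)[unfolded p_eq]
  define N where "N = dagger p e (int (\<alpha> * p + \<beta>))"
  define A :: "'p mod_ring poly" where "A = (\<Sum>i<e. monom (of_nat (a i)) i)"
  define Tr where "Tr = (linearized (geom_poly e :: 'p mod_ring poly) :: 'a \<Rightarrow> 'a)"
  define G where
    "G = poly (map_poly of_prime_field (g_poly TYPE('p mod_ring) n :: 'p mod_ring poly) :: 'a poly)"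
  define \<delta> :: 'a where "\<delta> = (if CARD('p) = 2 then 1 else 0)"
  have card: "CARD('a) = CARD('p) ^ e" using card_field card_p by simp
  have char: "CHAR('a) = CARD('p)"
    using CHAR_eq_if_CARD_eq_power[OF card] prime_card[where 'a = 'p] .
  have p: "CARD('p) > 1" by (rule nontriv)
  have pe: "CARD('p) ^ e > 1" using p \<open>e > 1\<close> by (intro one_less_power) auto

  have N_digits: "N = (\<Sum>i<e. a i * CARD('p) ^ i)"
    using assms(14) by (simp add: N_def p_eq)
  have N_cong: "[\<alpha> * CARD('p) + \<beta> = N] (mod (CARD('p) ^ e - 1))"
  proof -
    have "[int N = int (\<alpha> * CARD('p) + \<beta>)] (mod int (CARD('p) ^ e - 1))"
      unfolding N_def p_eq by (rule cong_dagger(2)[OF pe])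
    thus ?thesis by (simp only: cong_int_iff cong_sym_eq)
  qed
  have "N > 0" using cong_dagger(1)[OF pe] by (simp add: N_def p_eq Suc_le_eq)
  have wN: "base_weight CARD('p) N = CARD('p)"
    using assms(12) by (simp add: N_def p_eq)
  \<comment> \<open>The bound on \<open>a i\<close> makes them genuine digits, so the weight
    condition becomes a digit sum.\<close>
  have digits: "(\<Sum>i<e. a i) = CARD('p)"
  proof -
    have "a i < CARD('p)" if "i < e" for i using assms(15)[OF that] p card_p by simp
    from base_weight_digit_sum[OF p this] show ?thesis using wN by (simp add: N_digits)
  qed

  \<comment> \<open>Weights are read modulo p - 1: \<beta> becomes 0, \<open>N\<close> becomes p =
    1, and \<alpha> p + \<beta> becomes \<alpha>.\<close>
  have \<alpha>_cong: "[\<alpha> = 1] (mod (CARD('p) - 1))"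
  proof -
    define m where "m = CARD('p) - 1"
    have p1: "[CARD('p) = 1] (mod m)"
      using p unfolding m_def by (simp add: cong_altdef_nat)
    have "[\<beta> = 0] (mod m)"
      using cong_base_weight[OF p, of \<beta>] asm(8) by (simp add: m_def cong_def)
    hence "[\<alpha> * 1 + 0 = \<alpha> * CARD('p) + \<beta>] (mod m)"
      using p1 by (intro cong_add cong_mult cong_refl) (simp_all only: cong_sym_eq)
    also have "m dvd CARD('p) ^ e - 1"
      using cong_pow[OF p1, of e] pe by (simp add: cong_altdef_nat)
    hence "[\<alpha> * CARD('p) + \<beta> = N] (mod m)"
      by (rule cong_dvd_modulus_nat[OF N_cong])
    also have "[N = CARD('p)] (mod m)"
      using cong_base_weight[OF p, of N] unfolding wN m_def .
    also note p1
    finally show ?thesis by (simp add: m_def)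
  qed
  obtain l where l: "[\<alpha> = CARD('p) ^ l] (mod ((CARD('p) ^ e - 1) div (CARD('p) - 1)))"
    using asm(7) by blast

  have G1: "G y = - (y ^ \<alpha>)" if "Tr y \<noteq> 0" for y
    using g_poly_trace_nonzero[OF char card asm(8), of y \<alpha>] that
    unfolding G_def Tr_def assms(13) p_eq by blast
  have A_lin: "linearized A x = (\<Sum>i<e. of_nat (a i) * x ^ (CARD('p) ^ i))" for x :: 'a
    by (simp add: A_def linearized_sum_left[OF char] linearized_monom[OF char]
        of_prime_field_of_nat[OF char])
  have G2: "G (x ^ CARD('p) - x) = - linearized A x - \<delta>" for x
    unfolding G_def assms(13) p_eq A_lin \<delta>_def
    by (rule g_poly_trace_zero[OF char card \<open>\<alpha> > 0\<close> \<open>N > 0\<close> N_cong N_digits digits])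
  \<comment> \<open>The digit sum p vanishes in F_p, so 1 is a root of \<open>A\<close>.\<close>
  have dvdA: "[:-1, 1:] dvd A"
  proof -
    have "poly A 1 = of_nat (\<Sum>i<e. a i)" by (simp add: A_def poly_sum poly_monom)
    also have "\<dots> = 0" by (simp only: digits of_nat_card_eq_0)
    finally show ?thesis by (simp add: poly_eq_0_iff_dvd)
  qed
  have Tr_diff: "Tr (u - v) = Tr u - Tr v" and Tr_0: "Tr 0 = 0" for u v
    unfolding Tr_def by (simp_all only: linearized_diff[OF char] linearized_0[OF char])
  have Tr_A: "Tr (linearized A x) = 0" for x
    unfolding Tr_def by (rule trace_linearized_eq_0[OF char card dvdA])
  have Tr_AS: "Tr (x ^ CARD('p) - x) = 0" for x
    using trace_linearized_eq_0[OF char card, of "[:-1, 1:]" x]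
    by (simp add: Tr_def linearized_X_minus_1[OF char])
  have Tr_ker: "\<exists>x. y = x ^ CARD('p) - x" if "Tr y = 0" for y
    using trace_eq_0_imp[OF char card, of y] that \<open>e > 1\<close> by (simp add: Tr_def)
  \<comment> \<open>Tr(1) is e, which is 0 in characteristic 2 because e is even.\<close>
  have Tr_\<delta>: "Tr \<delta> = 0"
  proof (cases "CARD('p) = 2")
    case True
    hence "even e" using asm(2) by simp
    hence "of_nat e = (0 :: 'a)" by (simp add: of_nat_eq_0_iff_char_dvd char True)
    thus ?thesis using True by (simp add: \<delta>_def Tr_def linearized_geom_poly[OF char])
  qed (simp add: \<delta>_def Tr_0)
  \<comment> \<open>As an equivalence, this puts two arguments with equal values into the same case
    of the formula for \<open>G\<close>.\<close>
  have Tr_G: "Tr (G y) = 0 \<longleftrightarrow> Tr y = 0" for y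
  proof (cases "Tr y = 0")
    case True
    then obtain x where "y = x ^ CARD('p) - x" using Tr_ker by blast
    hence "G y = 0 - linearized A x - \<delta>" by (simp add: G2)
    hence "Tr (G y) = 0" by (simp only: Tr_diff Tr_0 Tr_A Tr_\<delta>) simp
    with True show ?thesis by simp
  next
    case False
    hence "y \<noteq> 0" using Tr_0 by auto
    then obtain c where c: "c \<noteq> 0" "c ^ CARD('p) = c" "y ^ \<alpha> = c * y ^ (CARD('p) ^ l)"
      using power_eq_mult_frobenius[OF card p l] by blast
    have "G y = 0 - y ^ \<alpha>" using G1[OF False] by simp
    hence "Tr (G y) = - (c * Tr y ^ (CARD('p) ^ l))"
      unfolding c(3) by (simp only: Tr_diff Tr_0)
        (simp add: Tr_def linearized_fixed_mult[OF c(2)] linearized_frobenius[OF char])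
    with False c(1) show ?thesis by simp
  qed

  have "inj G \<longleftrightarrow> (\<forall>x::'a. linearized A x = 0 \<longrightarrow> x ^ CARD('p) = x)"
  proof
    assume inj: "inj G"
    show "\<forall>x::'a. linearized A x = 0 \<longrightarrow> x ^ CARD('p) = x"
    proof (intro allI impI)
      fix x :: 'a assume "linearized A x = 0"
      \<comment> \<open>Writing 0 as \<open>0 ^ CARD('p) - 0\<close> lets \<open>G2\<close> evaluate
        both sides.\<close>
      hence "G (x ^ CARD('p) - x) = G (0 ^ CARD('p) - 0)"
        unfolding G2 by (simp add: linearized_0[OF char])
      from injD[OF inj this] show "x ^ CARD('p) = x" by (simp add: power_0_left)
    qed
  next
    assume ker: "\<forall>x::'a. linearized A x = 0 \<longrightarrow> x ^ CARD('p) = x"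
    show "inj G"
    proof (rule injI)
      fix y z assume eq: "G y = G z"
      show "y = z"
      proof (cases "Tr y = 0")
        case True
        hence "Tr z = 0" using eq Tr_G by metis
        obtain u v where uv: "y = u ^ CARD('p) - u" "z = v ^ CARD('p) - v"
          using Tr_ker True \<open>Tr z = 0\<close> by blast
        have "linearized A (u - v) = 0"
          using eq by (simp add: uv G2 linearized_diff[OF char])
        hence fixed: "(u - v) ^ CARD('p) = u - v" using ker by blast
        have "(u - v) ^ CARD('p) = u ^ CARD('p) - v ^ CARD('p)"
          using frobenius_diff[OF char, of u v 1] by (simp only: power_one_right)
        from trans[OF this [symmetric] fixed] show ?thesis
          unfolding uv by (simp add: algebra_simps)
      next
        case False
        hence "Tr z \<noteq> 0" using eq Tr_G by metis
        hence "z \<noteq> 0" "y \<noteq> 0" using False Tr_0 by auto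
        have "y ^ \<alpha> = z ^ \<alpha>" using eq False \<open>Tr z \<noteq> 0\<close> by (simp add: G1)
        hence "(y / z) ^ \<alpha> = 1" using \<open>z \<noteq> 0\<close> by (simp add: power_divide)
        from power_eq_1_imp[OF char card l \<alpha>_cong _ this] have "y / z = 1"
          using \<open>z \<noteq> 0\<close> \<open>y \<noteq> 0\<close> by simp
        thus ?thesis using \<open>z \<noteq> 0\<close> by simp
      qed
    qed
  qed
  moreover have "permutation_poly (map_poly of_prime_field (g_poly TYPE('p mod_ring) n :: 'p mod_ring poly) :: 'a poly)
      \<longleftrightarrow> inj G"
    unfolding permutation_poly_def G_def [symmetric] bij_def
    using finite_UNIV_inj_surj[OF finite, of G] by blast
  ultimately show ?thesis
    using linearized_kernel_iff_gcd[OF char card dvdA] by (simp only: A_def)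
qed

end
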